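(* Suppose that for some fixed constant $c>0$ the inequality $$\Pi\bigl(z,e^{\sqrt{\log z}}\bigr)\gg z\,e^{-c\sqrt{\log z}\,\log\log z}$$ holds for all sufficiently large $z$. Then for every $d>6+2c$, $$\mathcal N_{\mathcal C}(x)\gg x\,e^{-d\log x\frac{\log\log\log x}{\log\log x}}\quad (x\to+\infty).$$ In particular, if $$\frac{\Pi(z,y(z))}{\pi(z)}\sim\frac{\Psi(z,y(z))}{z}\quad (z\to+\infty)$$ holds for $y(z)=e^{\sqrt{\log z}}$, then $$\mathcal N_{\mathcal C}(x)\gg x\,e^{-(7+o(1))\log x\frac{\log\log\log x}{\log\log x}}.$$
   Context: A positive integer $N$ is called a Novák-Carmichael number if $a^N\equiv 1 \pmod N$ for every integer $a$ coprime to $N$. For real $x$, $\mathcal N_{\mathcal C}(x)$ denotes the number of Novák-Carmichael numbers $N\le x$. For real $x,y>0$, $\mathcal P(x,y)$ is the set of primes $p\le x$ such that every prime factor of $p-1$ is at most $y$, and $\Pi(x,y)=\#\mathcal P(x,y)$. $\pi(z)$ is the number of primes $\le z$, and $\Psi(z,y)$ is the number of positive integers $n\le z$ all of whose prime factors are $\le y$. *)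

theory Defs
  imports
    Complex_Main
    "HOL-Number_Theory.Number_Theory"
    "HOL-Library.Landau_Symbols"
begin

definition novak_carmichael :: "nat \<Rightarrow> bool" where
  "novak_carmichael N \<longleftrightarrow>
     N > 0 \<and> (\<forall>a::int. coprime a (int N) \<longrightarrow> [a ^ N = 1] (mod int N))"

definition NC_count :: "real \<Rightarrow> nat" where
  "NC_count x = card {N. novak_carmichael N \<and> real N \<le> x}"

definition smooth_shifted_primes :: "real \<Rightarrow> real \<Rightarrow> nat set" where
  "smooth_shifted_primes x y =
     {p. prime p \<and> real p \<le> x \<and> (\<forall>q. prime q \<and> q dvd p - 1 \<longrightarrow> real q \<le> y)}"

definition Pi_count :: "real \<Rightarrow> real \<Rightarrow> nat" where
  "Pi_count x y = card (smooth_shifted_primes x y)"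

definition prime_count :: "real \<Rightarrow> nat" where
  "prime_count z = card {p::nat. prime p \<and> real p \<le> z}"

definition Psi_count :: "real \<Rightarrow> real \<Rightarrow> nat" where
  "Psi_count z y =
     card {n::nat. n > 0 \<and> real n \<le> z \<and> (\<forall>q. prime q \<and> q dvd n \<longrightarrow> real q \<le> y)}"

end

theory Submission
  imports Defs "HOL-Real_Asymp.Real_Asymp"
begin

text \<open>
  A positive integer \<open>N\<close> with \<open>p - 1 dvd N\<close> for all primes \<open>p dvd N\<close> is a Novak-Carmichael number.
  Let \<open>L\<close> be the product of the largest powers \<open>q ^ e \<le> z\<close> of the primes \<open>q \<le> y\<close>, so that
  every \<open>y\<close>-smooth number up to \<open>z\<close> divides \<open>L\<close>. Then \<open>L\<close> times any product of \<open>k\<close> distinct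
  primes from \<open>\<P>(z, y)\<close> is a Novak-Carmichael number, and these \<open>\<Pi>(z, y) choose k\<close> numbers are
  distinct. With \<open>z = exp (t\<^sup>2)\<close>, \<open>y = exp t\<close>, \<open>t = ln (ln x) - 4 ln (ln (ln x))\<close>, the factor
  \<open>L \<le> exp (t\<^sup>2 exp t)\<close> is negligible, and taking \<open>k\<close> close to \<open>ln x / t\<^sup>2\<close> one loses only
  \<open>2 c k t ln t\<close> in the exponent, so every \<open>d > 2 c\<close> is admissible.

  For the second part, products of about \<open>t\<close> distinct primes up to \<open>exp t\<close>, together with a
  Chebyshev lower bound for \<open>\<pi>\<close>, give the hypothesis of the first part with \<open>c = 2\<close>. This
  already leads to the exponent \<open>7 > 2 c\<close> itself, hence \<open>\<epsilon> = 0\<close>. The Chebyshev bound comes from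
  the Leibniz triangle: its entries \<open>1 / (Suc n * (n choose m))\<close> are integer combinations of
  \<open>1, 1 / 2, \<dots>, 1 / Suc n\<close>.
\<close>

section \<open>A divisibility criterion for Novak-Carmichael numbers\<close>

lemma finite_nat_le_real: "finite {n::nat. P n \<and> real n \<le> x}"
  by (rule finite_subset[of _ "{..nat \<lfloor>x\<rfloor>}"]) (auto intro: le_nat_floor)

text \<open>If \<open>p ^ k\<close> is the exact power of \<open>p\<close> in \<open>N\<close>, then
  \<open>p ^ (k - 1)\<close> and \<open>p - 1\<close> are coprime and both divide \<open>N\<close>,
  so \<open>totient (p ^ k)\<close> divides \<open>N\<close>. Euler's theorem gives the congruence
  modulo \<open>p ^ k\<close>, and comparing multiplicities glues the prime powers together.\<close>

lemma novak_carmichaelI: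
  assumes "N > 0" and shift: "\<And>p. prime p \<Longrightarrow> p dvd N \<Longrightarrow> p - 1 dvd N"
  shows "novak_carmichael N"
  unfolding novak_carmichael_def
proof (intro conjI allI impI)
  fix a :: int
  assume cop: "coprime a (int N)"
  show "[a ^ N = 1] (mod int N)"
  \<comment> \<open>The multiplicity of any prime in 0 is 0 by convention, so comparing
    multiplicities needs a nonzero difference \<open>a ^ N - 1\<close>.\<close>
  proof (cases "a ^ N = 1")
    case False
    have "N dvd nat \<bar>a ^ N - 1\<bar>"
    proof (rule multiplicity_le_imp_dvd)
      fix p :: nat
      assume p: "prime p"
      define k where "k = multiplicity p N"
      have "p ^ k dvd nat \<bar>a ^ N - 1\<bar>"
      proof (cases "k = 0")
        case False
        have pk: "p ^ k dvd N" by (simp add: k_def multiplicity_dvd)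
        have pN: "p dvd N"
          using False by (metis dvd_power dvd_trans neq0_conv pk)
        have "coprime (p ^ (k - 1)) (p - 1)"
          using p by (intro coprime_power_left_iff[THEN iffD2] disjI1)
            (metis coprime_diff_one_right_nat prime_gt_0_nat)
        moreover have "p ^ (k - 1) dvd N"
          by (rule dvd_trans[OF le_imp_power_dvd pk]) simp
        ultimately have "totient (p ^ k) dvd N"
          using p False shift[OF p pN] by (simp add: totient_prime_power divides_mult)
        then obtain l where l: "N = totient (p ^ k) * l" ..
        have gt: "p ^ k > 1"
          using False p by (metis one_less_power prime_gt_1_nat neq0_conv)
        interpret residues "int (p ^ k)" "residue_ring (int (p ^ k))"
          using gt by unfold_locales (metis of_nat_1 of_nat_less_iff, simp)
        have "coprime a (int (p ^ k))"
          by (rule coprime_divisors[OF dvd_refl _ cop]) (use pk in \<open>simp only: int_dvd_int_iff\<close>)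
        then have "[a ^ totient (p ^ k) = 1] (mod int (p ^ k))"
          using euler_theorem[of a] by (simp only: nat_int)
        then have "[(a ^ totient (p ^ k)) ^ l = 1 ^ l] (mod int (p ^ k))"
          by (rule cong_pow)
        then have "int (p ^ k) dvd a ^ N - 1"
          by (simp add: l power_mult cong_iff_dvd_diff)
        then show ?thesis
          by (metis dvd_abs_iff int_dvd_int_iff int_nat_eq abs_ge_zero)
      qed simp
      then show "multiplicity p N \<le> multiplicity p (nat \<bar>a ^ N - 1\<bar>)"
        using False p unfolding k_def by (intro multiplicity_geI) auto
    qed (use \<open>N > 0\<close> in auto)
    then show ?thesis
      by (metis cong_iff_dvd_diff dvd_abs_iff int_dvd_int_iff int_nat_eq abs_ge_zero)
  qed simp
qed (fact \<open>N > 0\<close>)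

section \<open>A small common multiple of the smooth numbers up to z\<close>

text \<open>For \<open>z >= 1\<close> this is the lcm of all \<open>y\<close>-smooth positive
  integers up to \<open>z\<close>. With \<open>y = z = N\<close> it is the lcm of 1, ...,
  \<open>N\<close>, which the Chebyshev bound uses.\<close>

definition smooth_multiple :: "real \<Rightarrow> real \<Rightarrow> nat" where
  "smooth_multiple z y = (\<Prod>q\<in>{q. prime q \<and> real q \<le> y}. q ^ nat \<lfloor>log (real q) z\<rfloor>)"

lemma smooth_multiple_pos: "smooth_multiple z y > 0"
  unfolding smooth_multiple_def by (rule prod_pos) (simp add: prime_gt_0_nat)

lemma prime_dvd_smooth_multiple:
  assumes "prime p" "p dvd smooth_multiple z y"
  shows "real p \<le> y"
proof -
  obtain q where q: "prime q" "real q \<le> y" "p dvd q ^ nat \<lfloor>log (real q) z\<rfloor>"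
    using assms finite_nat_le_real[of prime y] unfolding smooth_multiple_def
    by (auto simp: prime_dvd_prod_iff)
  then have "p dvd q" using assms(1) prime_dvd_power by blast
  then show ?thesis using primes_dvd_imp_eq assms(1) q by blast
qed

lemma smooth_multiple_le:
  assumes "z \<ge> 1"
  shows "real (smooth_multiple z y) \<le> z ^ prime_count y"
proof -
  have "real (smooth_multiple z y)
      = (\<Prod>q\<in>{q. prime q \<and> real q \<le> y}. real q ^ nat \<lfloor>log (real q) z\<rfloor>)"
    unfolding smooth_multiple_def by simp
  also have "\<dots> \<le> (\<Prod>q\<in>{q. prime q \<and> real q \<le> y}. z)"
  proof (rule prod_mono, safe)
    fix q :: nat
    assume "prime q"
    then have q: "real q > 1" using prime_gt_1_nat by simp
    have "real q ^ nat \<lfloor>log (real q) z\<rfloor> = real q powr real (nat \<lfloor>log (real q) z\<rfloor>)"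
      using q by (simp add: powr_realpow)
    also have "\<dots> \<le> real q powr log (real q) z"
      using q assms by (intro powr_mono) auto
    also have "\<dots> = z" using q assms by simp
    finally show "real q ^ nat \<lfloor>log (real q) z\<rfloor> \<le> z" .
  qed simp
  finally show ?thesis by (simp add: prime_count_def)
qed

lemma smooth_dvd_smooth_multiple:
  assumes "n > 0" "real n \<le> z" and smooth: "\<And>q. prime q \<Longrightarrow> q dvd n \<Longrightarrow> real q \<le> y"
  shows "n dvd smooth_multiple z y"
proof (rule multiplicity_le_imp_dvd)
  fix p :: nat
  assume p: "prime p"
  show "multiplicity p n \<le> multiplicity p (smooth_multiple z y)"
  proof (cases "p dvd n")
    case True
    have p1: "real p > 1" using prime_gt_1_nat[OF p] by simp
    have "p ^ multiplicity p n \<le> n"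
      using \<open>n > 0\<close> by (simp add: dvd_imp_le multiplicity_dvd)
    then have "real p ^ multiplicity p n \<le> real n"
      by (metis of_nat_le_iff of_nat_power)
    then have "real p ^ multiplicity p n \<le> z" using assms(2) by linarith
    then have "real (multiplicity p n) \<le> log (real p) z"
      using p1 by (intro le_log_of_power)
    then have "multiplicity p n \<le> nat \<lfloor>log (real p) z\<rfloor>" by (rule le_nat_floor)
    also have "\<dots> \<le> multiplicity p (smooth_multiple z y)"
    proof (rule multiplicity_geI)
      show "p ^ nat \<lfloor>log (real p) z\<rfloor> dvd smooth_multiple z y"
        unfolding smooth_multiple_def
        using finite_nat_le_real[of prime y] p smooth[OF p True]
        by (intro dvd_prodI) auto
    qed (use p smooth_multiple_pos[of z y] in auto)
    finally show ?thesis .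
  qed (simp add: not_dvd_imp_multiplicity_0)
qed (use assms in simp)

section \<open>Counting products of distinct primes\<close>

text \<open>A finite set of primes is recovered from its product as the set of prime divisors, so
  distinct \<open>k\<close>-subsets yield distinct elements of \<open>B\<close>. The factor
  \<open>L\<close> is the smooth multiple when counting Novak-Carmichael numbers and 1 when counting
  smooth numbers.\<close>

lemma choose_le_card_prime_products:
  assumes "finite A" "\<And>p. p \<in> A \<Longrightarrow> prime (p::nat)" "L > 0" "finite B"
    and "\<And>S. S \<subseteq> A \<Longrightarrow> card S = k \<Longrightarrow> L * \<Prod>S \<in> B"
  shows "card A choose k \<le> card B"
proof -
  have "inj_on (\<lambda>S. L * \<Prod>S) {S. S \<subseteq> A \<and> card S = k}"
  proof (rule inj_onI)
    fix S T
    assume S: "S \<in> {S. S \<subseteq> A \<and> card S = k}" and T: "T \<in> {S. S \<subseteq> A \<and> card S = k}"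
      and eq: "L * \<Prod>S = L * \<Prod>T"
    have "U = {p. prime p \<and> p dvd \<Prod>U}" if "U \<subseteq> A" for U
    proof -
      have "finite U" using that assms(1) by (rule finite_subset)
      then show ?thesis
        using that assms(2) by (auto simp: prime_dvd_prod_iff primes_dvd_imp_eq)
          (metis primes_dvd_imp_eq subsetD)
    qed
    moreover have "\<Prod>S = \<Prod>T" using eq \<open>L > 0\<close> by simp
    moreover have "S \<subseteq> A" "T \<subseteq> A" using S T by auto
    ultimately show "S = T" by metis
  qed
  moreover have "(\<lambda>S. L * \<Prod>S) ` {S. S \<subseteq> A \<and> card S = k} \<subseteq> B" using assms(5) by auto
  ultimately have "card {S. S \<subseteq> A \<and> card S = k} \<le> card B"
    using \<open>finite B\<close> by (metis card_inj_on_le)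
  then show ?thesis using n_subsets[OF assms(1), of k] by simp
qed

lemma prod_le_power_card:
  assumes "\<And>p. p \<in> S \<Longrightarrow> real p \<le> z"
  shows "real (\<Prod>S) \<le> z ^ card S"
proof -
  have "real (\<Prod>S) = (\<Prod>p\<in>S. real p)" by simp
  also have "\<dots> \<le> (\<Prod>p\<in>S. z)" using assms by (intro prod_mono) auto
  finally show ?thesis by simp
qed

text \<open>A prime divisor \<open>p\<close> of \<open>?L * \<Prod>S\<close> is either at most
  \<open>y\<close> or a member of \<open>S\<close>. In both cases \<open>p - 1\<close> is
  \<open>y\<close>-smooth and at most \<open>z\<close>, so it divides \<open>?L\<close> alone,
  whatever \<open>S\<close> is.\<close>

lemma choose_le_NC_count:
  assumes "1 \<le> z" "y \<le> z" and x: "z ^ prime_count y * z ^ k \<le> x"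
  shows "Pi_count z y choose k \<le> NC_count x"
  unfolding Pi_count_def NC_count_def
proof (rule choose_le_card_prime_products)
  let ?A = "smooth_shifted_primes z y" and ?L = "smooth_multiple z y"
  have fin: "finite ?A"
    unfolding smooth_shifted_primes_def
    by (rule finite_subset[OF _ finite_nat_le_real[of prime z]]) auto
  then show "finite ?A" .
  show "prime p" if "p \<in> ?A" for p using that by (simp add: smooth_shifted_primes_def)
  show "?L > 0" by (rule smooth_multiple_pos)
  show "finite {N. novak_carmichael N \<and> real N \<le> x}" by (rule finite_nat_le_real)
  show "?L * \<Prod>S \<in> {N. novak_carmichael N \<and> real N \<le> x}"
    if S: "S \<subseteq> ?A" "card S = k" for S
  proof (intro CollectI conjI novak_carmichaelI)
    have finS: "finite S" using S(1) fin by (rule finite_subset)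
    have "\<Prod>S > 0"
      by (rule prod_pos) (use S(1) in \<open>auto simp: smooth_shifted_primes_def prime_gt_0_nat\<close>)
    then show "?L * \<Prod>S > 0"
      using smooth_multiple_pos[of z y] by simp
    show "p - 1 dvd ?L * \<Prod>S" if p: "prime p" "p dvd ?L * \<Prod>S" for p
    proof (rule dvd_mult2, rule smooth_dvd_smooth_multiple)
      have "real p \<le> y \<or> p \<in> ?A"
      proof (cases "p dvd ?L")
        case True
        then show ?thesis using prime_dvd_smooth_multiple p(1) by blast
      next
        case False
        then have "p dvd \<Prod>S" using p by (simp add: prime_dvd_mult_iff)
        then obtain r where r: "r \<in> S" "p dvd r" using finS p(1) by (auto simp: prime_dvd_prod_iff)
        then show ?thesis
          using S(1) p(1) primes_dvd_imp_eq[of p r] by (auto simp: smooth_shifted_primes_def)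
      qed
      then show "real (p - 1) \<le> z" and "\<And>q. prime q \<Longrightarrow> q dvd p - 1 \<Longrightarrow> real q \<le> y"
        using \<open>y \<le> z\<close> prime_gt_1_nat[OF p(1)]
        by (auto simp: smooth_shifted_primes_def dest: dvd_imp_le)
      show "p - 1 > 0" using prime_gt_1_nat[OF p(1)] by simp
    qed
    have "real (\<Prod>S) \<le> z ^ k"
      using prod_le_power_card[of S z] S by (auto simp: smooth_shifted_primes_def)
    then have "real ?L * real (\<Prod>S) \<le> z ^ prime_count y * z ^ k"
      using smooth_multiple_le[OF \<open>1 \<le> z\<close>, of y] assms(1)
      by (intro mult_mono) (auto simp del: of_nat_prod)
    then show "real (?L * \<Prod>S) \<le> x" using x by simp
  qed
qed

section \<open>A Chebyshev lower bound from the Leibniz triangle\<close>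

text \<open>With \<open>T n m\<close> the denominator of an entry, the triangle satisfies 1 / T(n+1,
  m+1) = 1 / T(n, m) - 1 / T(n+1, m). Column 0 consists of the numbers 1 / (n+1), which
  \<open>D\<close> turns into integers, and induction on the column carries this to all rows below
  \<open>N\<close>.\<close>

lemma leibniz_triangle_dvd:
  assumes "\<And>j. 0 < j \<Longrightarrow> j \<le> N \<Longrightarrow> j dvd D" "m \<le> n" "n < N"
  shows "Suc n * (n choose m) dvd D"
proof -
  have "real D / real (Suc n * (n choose m)) \<in> \<int>"
    using assms(2,3)
  proof (induction m arbitrary: n)
    case 0
    then have "Suc n dvd D" using assms(1) by auto
    then obtain l where "D = Suc n * l" ..
    then have "real D / real (Suc n * (n choose 0)) = real l"
      by (simp add: field_simps)
    then show ?case by simp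
  next
    case (Suc m n')
    then obtain n where n: "n' = Suc n" "m \<le> n" by (cases n') auto
    define T where "T n m = real (Suc n * (n choose m))" for n m
    have pos: "T n m > 0" unfolding T_def of_nat_0_less_iff using n by simp
    \<comment> \<open>Both neighbours in row \<open>Suc n\<close> are expressed through
      \<open>T n m\<close> by the absorption identities; the recurrence then reduces to (m+1) +
      (n+1-m) = n+2.\<close>
    have a: "real (Suc m) * T (Suc n) (Suc m) = real (n + 2) * T n m"
      using arg_cong[OF Suc_times_binomial_eq[of n m], of real]
      by (simp add: T_def algebra_simps del: binomial_Suc_Suc)
    have "(Suc n - m) * (Suc n choose m) = Suc n * (n choose m)"
      using binomial_absorb_comp[of "Suc n" m] by simp
    then have "real (Suc n - m) * real (Suc n choose m) = real (Suc n) * real (n choose m)"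
      by (metis of_nat_mult)
    then have b: "(real n + 1 - real m) * T (Suc n) m = real (n + 2) * T n m"
      using n by (simp add: T_def of_nat_diff algebra_simps)
    have nm: "real m \<le> real n" using n by simp
    have a': "T (Suc n) (Suc m) = real (n + 2) * T n m / real (Suc m)"
      using a by (simp add: field_simps)
    have b': "T (Suc n) m = real (n + 2) * T n m / (real n + 1 - real m)"
      using b nm by (simp add: field_simps)
    have "real D / T (Suc n) (Suc m) = real D / T n m - real D / T (Suc n) m"
    proof -
      have "real (Suc m) / real (n + 2) = 1 - (real n + 1 - real m) / real (n + 2)"
        by (simp add: field_simps)
      then have "real D / T n m * (real (Suc m) / real (n + 2))
          = real D / T n m - real D / T n m * ((real n + 1 - real m) / real (n + 2))"
        by (simp only: right_diff_distrib mult_1_right)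
      then show ?thesis unfolding a' b' by (simp add: mult.commute)
    qed
    moreover have "real D / T n m \<in> \<int>" "real D / T (Suc n) m \<in> \<int>"
      using Suc.IH[of n] Suc.IH[of "Suc n"] Suc.prems n by (auto simp: T_def)
    ultimately show ?case unfolding n T_def by (metis Ints_diff)
  qed
  then obtain i where "real D / real (Suc n * (n choose m)) = of_int i" by (auto elim: Ints_cases)
  moreover have "real (Suc n * (n choose m)) \<noteq> 0"
    unfolding of_nat_eq_0_iff using \<open>m \<le> n\<close> by simp
  ultimately have "real D = real_of_int i * real (Suc n * (n choose m))"
    by (metis nonzero_divide_eq_eq)
  then have "int D = i * int (Suc n * (n choose m))"
    by (metis of_int_eq_iff of_int_mult of_int_of_nat_eq)
  then show ?thesis by (metis dvd_triv_right int_dvd_int_iff)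
qed

lemma prime_count_mono: "x \<le> y \<Longrightarrow> prime_count x \<le> prime_count y"
  unfolding prime_count_def by (intro card_mono finite_nat_le_real) auto

lemma prime_count_le:
  assumes "y \<ge> 0"
  shows "real (prime_count y) \<le> y"
proof -
  have "prime_count y \<le> card {1..nat \<lfloor>y\<rfloor>}" unfolding prime_count_def
    by (intro card_mono) (auto intro: le_nat_floor simp: Suc_le_eq prime_gt_0_nat)
  then show ?thesis using \<open>y \<ge> 0\<close> by simp linarith
qed

text \<open>The lcm of 1, ..., \<open>N\<close> with \<open>N = 2 * m + 1\<close> is a multiple of
  \<open>N * (2 * m choose m)\<close>, hence at least \<open>4 ^ m\<close>, while it is at most
  \<open>N ^ prime_count N\<close>. Taking logarithms gives the bound.\<close>

lemma prime_count_mult_ln_ge: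
  assumes "x \<ge> 3"
  shows "real (prime_count x) * ln x \<ge> (x - 3) * ln 2"
proof -
  \<comment> \<open>The largest \<open>m\<close> with \<open>2 * m + 1 <= x\<close>; rounding down
    costs less than 1 in \<open>m\<close>, which is where \<open>x - 3\<close> comes from.\<close>
  define m where "m = nat \<lfloor>(x - 1) / 2\<rfloor>"
  define N where "N = 2 * m + 1"
  have m: "m > 0" "real m \<ge> (x - 3) / 2" "real N \<le> x"
    using assms of_int_floor_le[of "(x - 1) / 2"] real_of_int_floor_add_one_gt[of "(x - 1) / 2"]
    unfolding m_def N_def by (simp_all add: field_simps)
  let ?L = "smooth_multiple (real N) (real N)"
  have "Suc (2 * m) * (2 * m choose m) dvd ?L"
  proof (rule leibniz_triangle_dvd[of N])
    show "j dvd ?L" if "0 < j" "j \<le> N" for j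
      using that by (intro smooth_dvd_smooth_multiple) (auto dest: dvd_imp_le)
  qed (auto simp: N_def)
  then have "N * (2 * m choose m) \<le> ?L"
    using smooth_multiple_pos by (simp add: N_def dvd_imp_le)
  then have 1: "real N * real (2 * m choose m) \<le> real ?L" by (metis of_nat_le_iff of_nat_mult)
  \<comment> \<open>The factor \<open>N\<close>, at least \<open>2 * m\<close>, cancels the
    denominator of the central binomial bound \<open>4 ^ m / (2 * m)\<close>.\<close>
  have "4 ^ m = 2 * real m * (4 ^ m / (2 * real m))" using m by simp
  also have "\<dots> \<le> real N * real (2 * m choose m)"
    using central_binomial_lower_bound[OF m(1)] by (intro mult_mono) (auto simp: N_def)
  also note 1
  also have "real ?L \<le> real N ^ prime_count (real N)"
    by (rule smooth_multiple_le) (simp add: N_def)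
  finally have "ln (4 ^ m :: real) \<le> ln (real N ^ prime_count (real N))"
    by (subst ln_le_cancel_iff) (auto simp: N_def)
  then have "real m * ln 4 \<le> real (prime_count (real N)) * ln (real N)"
    by (simp add: ln_realpow N_def)
  also have "\<dots> \<le> real (prime_count x) * ln x"
    using prime_count_mono[OF m(3)] m(3) assms by (intro mult_mono) (auto simp: N_def)
  finally have "real m * (2 * ln 2) \<le> real (prime_count x) * ln x"
    using ln_realpow[of 2 2] by simp
  moreover have "(x - 3) / 2 * (2 * ln 2) \<le> real m * (2 * ln 2)"
    using m by (intro mult_right_mono) auto
  ultimately show ?thesis by (simp add: field_simps)
qed

section \<open>Explicit lower bounds from binomial coefficients\<close>

lemma choose_le_Psi_count:
  assumes "y ^ k \<le> z"
  shows "prime_count y choose k \<le> Psi_count z y"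
  unfolding prime_count_def Psi_count_def
proof (rule choose_le_card_prime_products)
  show "finite {p. prime p \<and> real p \<le> y}" by (rule finite_nat_le_real)
  show "finite {n. 0 < n \<and> real n \<le> z \<and> (\<forall>q. prime q \<and> q dvd n \<longrightarrow> real q \<le> y)}"
    by (rule finite_subset[OF _ finite_nat_le_real[of "\<lambda>n. n > 0" z]]) auto
  show "1 * \<Prod>S \<in> {n. 0 < n \<and> real n \<le> z \<and> (\<forall>q. prime q \<and> q dvd n \<longrightarrow> real q \<le> y)}"
    if S: "S \<subseteq> {p. prime p \<and> real p \<le> y}" "card S = k" for S
  proof -
    have "finite S" using S(1) finite_nat_le_real by (rule finite_subset)
    then have "real q \<le> y" if "prime q" "q dvd \<Prod>S" for q
      using that S(1) by (auto simp: prime_dvd_prod_iff) (metis (mono_tags) mem_Collect_eq primes_dvd_imp_eq subsetD)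
    moreover have "real (\<Prod>S) \<le> z"
      using prod_le_power_card[of S y] S assms by force
    moreover have "\<Prod>S > 0"
      by (rule prod_pos) (use S(1) in \<open>auto simp: prime_gt_0_nat\<close>)
    ultimately show ?thesis by auto
  qed
qed auto

text \<open>Here \<open>X\<close> is the logarithm of the counting bound and \<open>B\<close> the
  loss in the supply of smooth shifted primes. From \<open>M choose k >= (M / k) ^ k\<close> and
  \<open>k <= X\<close>, each of the \<open>k\<close> factors contributes at least
  \<open>t\<^sup>2 - B - ln X\<close> to the exponent. The subtracted terms pay for the smooth
  multiple, for rounding \<open>k\<close>, and for the loss \<open>B + ln X\<close> in at most
  \<open>X / t\<^sup>2\<close> factors. The hypotheses on \<open>X\<close> and \<open>B\<close>
  ensure \<open>1 <= k <= M\<close>.\<close>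

lemma NC_count_exp_ge:
  fixes t B X :: real
  assumes t: "t \<ge> 1" and M: "real (Pi_count (exp (t\<^sup>2)) (exp t)) \<ge> exp (t\<^sup>2 - B)"
    and X: "X - exp t * t\<^sup>2 \<ge> t\<^sup>2" and B: "B + ln X \<le> t\<^sup>2" "B + ln X \<ge> 0"
  shows "real (NC_count (exp X)) \<ge> exp (X - exp t * t\<^sup>2 - t\<^sup>2 - X / t\<^sup>2 * (B + ln X))"
proof -
  \<comment> \<open>As many primes up to \<open>exp (t\<^sup>2)\<close> as fit below
    \<open>exp X\<close> once \<open>exp t * t\<^sup>2\<close> is reserved for the smooth multiple,
    by the trivial bound \<open>prime_count y <= y\<close>.\<close>
  define k where "k = nat \<lfloor>(X - exp t * t\<^sup>2) / t\<^sup>2\<rfloor>"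
  define M where "M = Pi_count (exp (t\<^sup>2)) (exp t)"
  have t2: "t\<^sup>2 \<ge> 1" using t by simp
  have E: "0 \<le> exp t * t\<^sup>2" by simp
  have q: "1 \<le> (X - exp t * t\<^sup>2) / t\<^sup>2" using X t2 by (subst pos_le_divide_eq) auto
  then have k1: "k \<ge> 1" unfolding k_def by linarith
  have t2': "t\<^sup>2 > 0" using t2 by linarith
  have "real k \<le> (X - exp t * t\<^sup>2) / t\<^sup>2" "(X - exp t * t\<^sup>2) / t\<^sup>2 \<le> real k + 1"
    using q unfolding k_def by linarith+
  then have k: "real k * t\<^sup>2 \<le> X - exp t * t\<^sup>2" "real k * t\<^sup>2 \<ge> X - exp t * t\<^sup>2 - t\<^sup>2"
    by (simp_all add: pos_le_divide_eq[OF t2'] pos_divide_le_eq[OF t2'] distrib_right)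
  have kX: "real k * t\<^sup>2 \<le> X" using k E by linarith
  moreover have "real k * 1 \<le> real k * t\<^sup>2" using t2 by (intro mult_left_mono) auto
  ultimately have kX': "real k \<le> X" by linarith
  have X0: "X > 0" using X E t2 by linarith
  have "real k * exp (t\<^sup>2 - B - ln X) \<le> X * exp (t\<^sup>2 - B - ln X)"
    using kX' by (intro mult_right_mono) auto
  also have "\<dots> = exp (t\<^sup>2 - B)" using X0 by (simp add: exp_diff)
  also have "\<dots> \<le> real M" using M by (simp add: M_def)
  finally have Mk: "real k * exp (t\<^sup>2 - B - ln X) \<le> real M" .
  have "real k * 1 \<le> real k * exp (t\<^sup>2 - B - ln X)" using B by (intro mult_left_mono) auto
  then have kM: "k \<le> M" using Mk by linarith
  have "X - exp t * t\<^sup>2 - t\<^sup>2 - X / t\<^sup>2 * (B + ln X) \<le> real k * t\<^sup>2 - real k * (B + ln X)"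
  proof -
    have "real k \<le> X / t\<^sup>2" using kX by (simp add: pos_le_divide_eq[OF t2'])
    then have "real k * (B + ln X) \<le> X / t\<^sup>2 * (B + ln X)" using B by (intro mult_right_mono)
    then show ?thesis using k by linarith
  qed
  then have "exp (X - exp t * t\<^sup>2 - t\<^sup>2 - X / t\<^sup>2 * (B + ln X)) \<le> exp (real k * (t\<^sup>2 - B - ln X))"
    by (simp add: algebra_simps)
  also have "\<dots> = exp (t\<^sup>2 - B - ln X) ^ k" by (rule exp_of_nat_mult)
  also have "\<dots> \<le> (real M / real k) ^ k"
    using Mk k1 by (intro power_mono) (auto simp: field_simps)
  also have "\<dots> \<le> real (M choose k)" using kM by (rule binomial_ge_n_over_k_pow_k)
  also have "\<dots> \<le> real (NC_count (exp X))"
    unfolding of_nat_le_iff M_def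
  proof (rule choose_le_NC_count)
    show "exp t \<le> exp (t\<^sup>2)" using t by (simp add: power2_eq_square)
    have "exp (t\<^sup>2) ^ prime_count (exp t) * exp (t\<^sup>2) ^ k
        = exp (real (prime_count (exp t)) * t\<^sup>2 + real k * t\<^sup>2)"
      by (simp add: exp_of_nat_mult exp_add)
    also have "\<dots> \<le> exp X"
    proof -
      have "real (prime_count (exp t)) * t\<^sup>2 \<le> exp t * t\<^sup>2"
        using prime_count_le[of "exp t"] by (intro mult_right_mono) auto
      then show ?thesis using k by simp
    qed
    finally show "exp (t\<^sup>2) ^ prime_count (exp t) * exp (t\<^sup>2) ^ k \<le> exp X" .
  qed simp
  finally show ?thesis .
qed

section \<open>Asymptotic estimates\<close>

lemma eventually_NC_count_ge:
  fixes c d C :: real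
  assumes "c > 0" "C > 0" "d > 2 * c"
    and ev: "eventually (\<lambda>z. real (Pi_count z (exp (sqrt (ln z))))
      \<ge> C * (z * exp (- c * sqrt (ln z) * ln (ln z)))) at_top"
  shows "eventually (\<lambda>x. real (NC_count x)
      \<ge> x * exp (- d * ln x * (ln (ln (ln x)) / ln (ln x)))) at_top"
proof -
  \<comment> \<open>The variable \<open>w\<close> stands for \<open>ln (ln x)\<close>, so
    \<open>X = exp w\<close>. Subtracting \<open>4 * ln w\<close> makes
    \<open>exp (t w) * t w ^ 2\<close> of order \<open>exp w / w ^ 2\<close>, below the allowed loss
    \<open>exp w * ln w / w\<close>.\<close>
  define t :: "real \<Rightarrow> real" where "t w = w - 4 * ln w" for w
  \<comment> \<open>At \<open>z = exp ((t w)\<^sup>2)\<close> the assumed factor has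
    \<open>sqrt (ln z) = t w\<close> and \<open>ln (ln z) = 2 * ln (t w)\<close>; the constant
    \<open>C\<close> enters as \<open>- ln C\<close>.\<close>
  define B where "B w = 2 * c * (t w * ln (t w)) - ln C" for w
  \<comment> \<open>Each loss term is divided by \<open>exp w * ln w / w\<close>. Only the main part
    of \<open>B\<close> survives, with limit \<open>2 * c\<close>, hence the condition
    \<open>d > 2 * c\<close>.\<close>
  have lim1: "((\<lambda>w. exp (t w) * t w ^ 2 / exp w * (w / ln w)) \<longlongrightarrow> 0) at_top"
    "((\<lambda>w. t w ^ 2 / exp w * (w / ln w)) \<longlongrightarrow> 0) at_top"
    "((\<lambda>w. t w * ln (t w) / t w ^ 2 * (w / ln w)) \<longlongrightarrow> 1) at_top"
    "((\<lambda>w. w / t w ^ 2 * (w / ln w)) \<longlongrightarrow> 0) at_top"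
    "((\<lambda>w. 1 / t w ^ 2 * (w / ln w)) \<longlongrightarrow> 0) at_top"
    unfolding t_def by real_asymp+
  have "((\<lambda>w. exp (t w) * t w ^ 2 / exp w * (w / ln w) + t w ^ 2 / exp w * (w / ln w)
      + (2 * c * (t w * ln (t w) / t w ^ 2 * (w / ln w)) - ln C * (1 / t w ^ 2 * (w / ln w))
      + w / t w ^ 2 * (w / ln w))) \<longlongrightarrow> 0 + 0 + (2 * c * 1 - ln C * 0 + 0)) at_top"
    by (intro tendsto_intros lim1)
  then have bound: "eventually (\<lambda>w. exp (t w) * t w ^ 2 / exp w * (w / ln w)
      + t w ^ 2 / exp w * (w / ln w)
      + (2 * c * (t w * ln (t w) / t w ^ 2 * (w / ln w)) - ln C * (1 / t w ^ 2 * (w / ln w))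
      + w / t w ^ 2 * (w / ln w)) < d) at_top"
    by (rule order_tendstoD) (use assms in simp)
  have lim2: "((\<lambda>w. t w * ln (t w) / t w ^ 2) \<longlongrightarrow> 0) at_top"
    "((\<lambda>w. w / t w ^ 2) \<longlongrightarrow> 0) at_top" "((\<lambda>w. 1 / t w ^ 2) \<longlongrightarrow> 0) at_top"
    unfolding t_def by real_asymp+
  have "((\<lambda>w. 2 * c * (t w * ln (t w) / t w ^ 2) - ln C * (1 / t w ^ 2) + w / t w ^ 2)
      \<longlongrightarrow> 2 * c * 0 - ln C * 0 + 0) at_top"
    by (intro tendsto_intros lim2)
  then have Bsmall: "eventually (\<lambda>w. 2 * c * (t w * ln (t w) / t w ^ 2)
      - ln C * (1 / t w ^ 2) + w / t w ^ 2 < 1) at_top"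
    by (rule order_tendstoD) simp
  have t_top: "filterlim (\<lambda>w. exp ((t w)\<^sup>2)) at_top at_top"
    unfolding t_def by real_asymp
  have t1: "eventually (\<lambda>w. t w \<ge> 1) at_top"
    and room: "eventually (\<lambda>w. exp w - exp (t w) * (t w)\<^sup>2 \<ge> (t w)\<^sup>2) at_top"
    unfolding t_def by real_asymp+
  have "eventually (\<lambda>w. real (NC_count (exp (exp w)))
      \<ge> exp (exp w) * exp (- d * exp w * (ln w / w))) at_top"
    using bound Bsmall t1 room eventually_compose_filterlim[OF ev t_top]
      eventually_ge_at_top[of "ln C"] eventually_gt_at_top[of 1]
  proof eventually_elim
    case (elim w)
    have t2: "(t w)\<^sup>2 > 0" using elim(3) by simp
    have lw: "ln w > 0" "w > 0" using elim(7) by auto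
    have NC: "real (NC_count (exp (exp w))) \<ge> exp (exp w - exp (t w) * (t w)\<^sup>2 - (t w)\<^sup>2
        - exp w / (t w)\<^sup>2 * (B w + ln (exp w)))"
    proof (rule NC_count_exp_ge)
      have "(t w)\<^sup>2 - B w = ln C + ((t w)\<^sup>2 + - c * t w * ln ((t w)\<^sup>2))"
        using elim(3) by (simp add: B_def ln_realpow)
      then have "exp ((t w)\<^sup>2 - B w) = C * (exp ((t w)\<^sup>2) * exp (- c * t w * ln ((t w)\<^sup>2)))"
        using \<open>C > 0\<close> by (simp only: exp_add exp_ln)
      also have "\<dots> \<le> real (Pi_count (exp ((t w)\<^sup>2)) (exp (t w)))"
        using elim(3,5) by (simp add: real_sqrt_abs)
      finally show "exp ((t w)\<^sup>2 - B w) \<le> real (Pi_count (exp ((t w)\<^sup>2)) (exp (t w)))" .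
      have "2 * c * (t w * ln (t w)) \<ge> 0" using elim(3) \<open>c > 0\<close> by simp
      \<comment> \<open>Here \<open>elim(6)\<close> is \<open>w >= ln C\<close>, which compensates
        the term \<open>- ln C\<close> when \<open>C > 1\<close>.\<close>
      then show "0 \<le> B w + ln (exp w)" using elim(6) by (simp add: B_def)
      show "B w + ln (exp w) \<le> (t w)\<^sup>2"
      proof -
        have "(B w + w) / (t w)\<^sup>2 < 1"
          using elim(2) by (simp add: B_def add_divide_distrib diff_divide_distrib)
        then show ?thesis using pos_divide_less_eq[OF t2] by simp
      qed
    qed (use elim in auto)
    have "exp w * (exp (t w) * t w ^ 2 / exp w * (w / ln w)
        + t w ^ 2 / exp w * (w / ln w)
        + (2 * c * (t w * ln (t w) / t w ^ 2 * (w / ln w)) - ln C * (1 / t w ^ 2 * (w / ln w))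
        + w / t w ^ 2 * (w / ln w))) * (ln w / w) \<le> exp w * d * (ln w / w)"
      using elim(1) lw by (intro mult_left_mono mult_right_mono) auto
    then have le: "exp (t w) * (t w)\<^sup>2 + (t w)\<^sup>2 + exp w / (t w)\<^sup>2 * (B w + ln (exp w))
        \<le> exp w * d * (ln w / w)"
      using lw t2 by (simp add: B_def ring_distribs add_divide_distrib diff_divide_distrib)
    have "exp (exp w) * exp (- d * exp w * (ln w / w)) = exp (exp w - exp w * d * (ln w / w))"
      by (simp add: mult_ac flip: exp_add)
    also have "\<dots> \<le> exp (exp w - exp (t w) * (t w)\<^sup>2 - (t w)\<^sup>2
        - exp w / (t w)\<^sup>2 * (B w + ln (exp w)))"
      unfolding exp_le_cancel_iff using le by linarith
    also note NC
    finally show ?case .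
  qed
  moreover have "filterlim (\<lambda>x::real. ln (ln x)) at_top at_top" by real_asymp
  ultimately have "eventually (\<lambda>x. real (NC_count (exp (exp (ln (ln x)))))
      \<ge> exp (exp (ln (ln x))) * exp (- d * exp (ln (ln x)) * (ln (ln (ln x)) / ln (ln x)))) at_top"
    by (rule eventually_compose_filterlim)
  then show ?thesis
    using eventually_gt_at_top[of 1] by eventually_elim simp
qed

text \<open>Products of \<open>k = nat \<lfloor>t\<rfloor>\<close> distinct primes up to
  \<open>exp t\<close> stay below \<open>exp (t\<^sup>2)\<close>, and there are at least
  \<open>(M / k) ^ k\<close> of them.\<close>

lemma eventually_Psi_count_ge:
  "eventually (\<lambda>t. real (Psi_count (exp (t\<^sup>2)) (exp t)) \<ge> exp (t\<^sup>2 - 7 / 2 * (t * ln t))) at_top"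
proof -
  \<comment> \<open>Chebyshev and \<open>k <= t\<close> bound \<open>M / k\<close> below by a
    constant times \<open>exp t / t\<^sup>2\<close>; a third factor \<open>t\<close> absorbs the
    constant. As \<open>k >= t - 1\<close>, the exponent loses \<open>3 * t * ln t\<close> plus
    terms of order \<open>t\<close>, which \<open>7 / 2\<close> in place of 3 covers.\<close>
  have "eventually (\<lambda>t::real. (exp t - 3) * ln 2 / t\<^sup>2 \<ge> exp (t - 3 * ln t)) at_top"
    "eventually (\<lambda>t::real. t - 3 * ln t \<ge> 0) at_top"
    "eventually (\<lambda>t::real. (t - 1) * (t - 3 * ln t) \<ge> t\<^sup>2 - 7 / 2 * (t * ln t)) at_top"
    by real_asymp+
  then show ?thesis using eventually_ge_at_top[of 2]
  proof eventually_elim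
    case (elim t)
    define k where "k = nat \<lfloor>t\<rfloor>"
    define M where "M = prime_count (exp t)"
    have k: "real k \<le> t" "t - 1 \<le> real k" "k > 0" using elim(4) unfolding k_def by linarith+
    have "3 \<le> exp t" using exp_ge_add_one_self[of t] elim(4) by linarith
    then have "(exp t - 3) * ln 2 \<le> real M * t"
      using prime_count_mult_ln_ge[of "exp t"] by (simp add: M_def)
    then have "(exp t - 3) * ln 2 / t\<^sup>2 \<le> real M * t / t\<^sup>2"
      by (intro divide_right_mono) auto
    also have "\<dots> = real M / t" using elim(4) by (simp add: power2_eq_square)
    also have "\<dots> \<le> real M / real k" using k by (intro divide_left_mono) auto
    finally have Mk: "exp (t - 3 * ln t) \<le> real M / real k" using elim(1) by linarith
    moreover have "1 \<le> exp (t - 3 * ln t)" using elim(2) by simp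
    ultimately have "1 \<le> real M / real k" by linarith
    then have kM: "k \<le> M" using k(3) by (simp add: field_simps)
    have "(t - 1) * (t - 3 * ln t) \<le> real k * (t - 3 * ln t)"
      using k elim(2) by (intro mult_right_mono)
    then have "exp (t\<^sup>2 - 7 / 2 * (t * ln t)) \<le> exp (real k * (t - 3 * ln t))"
      using elim(3) by simp
    also have "\<dots> = exp (t - 3 * ln t) ^ k" by (rule exp_of_nat_mult)
    also have "\<dots> \<le> (real M / real k) ^ k" using Mk by (intro power_mono) auto
    also have "\<dots> \<le> real (M choose k)" using kM by (rule binomial_ge_n_over_k_pow_k)
    also have "\<dots> \<le> real (Psi_count (exp (t\<^sup>2)) (exp t))"
      unfolding of_nat_le_iff M_def
    proof (rule choose_le_Psi_count)
      have "real k * t \<le> t * t" using k elim(4) by (intro mult_right_mono) auto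
      then show "exp t ^ k \<le> exp (t\<^sup>2)" by (simp add: power2_eq_square flip: exp_of_nat_mult)
    qed
    finally show ?case .
  qed
qed

text \<open>With \<open>t = sqrt (ln z)\<close>, the smooth density costs
  \<open>7 / 2 * (t * ln t)\<close> and the prime count \<open>1 / 2 * (t * ln t)\<close> in the
  exponent. The sum \<open>4 * (t * ln t)\<close> equals \<open>2 * t * ln (ln z)\<close>, which is
  the case \<open>c = 2\<close>.\<close>

lemma eventually_Pi_count_ge:
  fixes K :: real
  assumes "K > 0"
    and ev: "eventually (\<lambda>z. real (Pi_count z (exp (sqrt (ln z)))) / real (prime_count z)
      \<ge> K * (real (Psi_count z (exp (sqrt (ln z)))) / z)) at_top"
  shows "eventually (\<lambda>z. real (Pi_count z (exp (sqrt (ln z))))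
      \<ge> K * (z * exp (- 2 * sqrt (ln z) * ln (ln z)))) at_top"
proof -
  have "filterlim (\<lambda>z::real. sqrt (ln z)) at_top at_top" by real_asymp
  note Psi = eventually_compose_filterlim[OF eventually_Psi_count_ge this]
  \<comment> \<open>The Chebyshev factor \<open>1 / ln z\<close> is only a power of
    \<open>t\<close>, so an exponential loss in \<open>t * ln t\<close> with any positive
    coefficient absorbs it; \<open>1 / 2\<close> rounds the total to 4.\<close>
  have "eventually (\<lambda>z::real. (z - 3) * ln 2 / ln z
      \<ge> z * exp (- (1 / 2) * (sqrt (ln z) * ln (sqrt (ln z))))) at_top"
    by real_asymp
  then show ?thesis using Psi ev eventually_gt_at_top[of 3]
  proof eventually_elim
    case (elim z)
    define t where "t = sqrt (ln z)"
    have lnz: "ln z > 0" using elim(4) by simp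
    then have t: "t > 0" "t\<^sup>2 = ln z" by (simp_all add: t_def)
    have lnt: "ln (ln z) = 2 * ln t" using t(1) by (simp add: ln_realpow flip: t(2))
    have z: "exp (t\<^sup>2) = z" using t elim(4) by simp
    have pi: "z * exp (- (1 / 2) * (t * ln t)) \<le> real (prime_count z)"
    proof -
      have "(z - 3) * ln 2 / ln z \<le> real (prime_count z)"
        using prime_count_mult_ln_ge[of z] elim(4) lnz by (simp add: field_simps)
      then show ?thesis using elim(1) by (simp add: t_def)
    qed
    have "z * exp (- (1 / 2) * (t * ln t)) > 0" using elim(4) by simp
    then have pos: "real (prime_count z) > 0" using pi by linarith
    have psi: "exp (- (7 / 2) * (t * ln t)) \<le> real (Psi_count z (exp t)) / z"
    proof -
      have "z * exp (- (7 / 2) * (t * ln t)) = exp (t\<^sup>2 - 7 / 2 * (t * ln t))"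
        by (simp add: z[symmetric] flip: exp_add)
      also have "\<dots> \<le> real (Psi_count z (exp t))" using elim(2) z by (simp flip: t_def)
      finally show ?thesis using elim(4) by (simp add: field_simps)
    qed
    have "K * (z * exp (- 2 * t * ln (ln z)))
        = z * exp (- (1 / 2) * (t * ln t)) * (K * exp (- (7 / 2) * (t * ln t)))"
      by (simp add: lnt flip: exp_add)
    also have "\<dots> \<le> real (prime_count z) * (K * (real (Psi_count z (exp t)) / z))"
      using pi psi \<open>K > 0\<close> by (intro mult_mono mult_left_mono) auto
    also have "\<dots> \<le> real (prime_count z) * (real (Pi_count z (exp t)) / real (prime_count z))"
      using elim(3) by (intro mult_left_mono) (auto simp: t_def)
    also have "\<dots> = real (Pi_count z (exp t))" using pos by simp
    finally show ?case by (simp add: t_def)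
  qed
qed

theorem theorem2:
  shows "(\<forall>c::real. c > 0 \<longrightarrow>
            (\<lambda>z::real. real (Pi_count z (exp (sqrt (ln z)))))
              \<in> \<Omega>[at_top](\<lambda>z. z * exp (- c * sqrt (ln z) * ln (ln z))) \<longrightarrow>
            (\<forall>d::real. d > 6 + 2 * c \<longrightarrow>
              (\<lambda>x::real. real (NC_count x))
                \<in> \<Omega>[at_top](\<lambda>x. x * exp (- d * ln x * (ln (ln (ln x)) / ln (ln x))))))
       \<and>
         ((\<lambda>z::real. real (Pi_count z (exp (sqrt (ln z)))) / real (prime_count z))
            \<sim>[at_top] (\<lambda>z. real (Psi_count z (exp (sqrt (ln z)))) / z) \<longrightarrow>
          (\<exists>\<epsilon>::real \<Rightarrow> real. \<epsilon> \<in> o[at_top](\<lambda>_. 1) \<and>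
            (\<lambda>x::real. real (NC_count x))
              \<in> \<Omega>[at_top](\<lambda>x. x * exp (- (7 + \<epsilon> x) * ln x * (ln (ln (ln x)) / ln (ln x))))))"
proof (intro conjI allI impI)
  \<comment> \<open>The implied constant can be 1, since the strict inequality
    \<open>d > 2 * c\<close> leaves room to absorb \<open>C\<close>.\<close>
  have omega: "(\<lambda>x::real. real (NC_count x))
      \<in> \<Omega>[at_top](\<lambda>x. x * exp (- d * ln x * (ln (ln (ln x)) / ln (ln x))))"
    if "c > 0" "C > 0" "d > 2 * c"
      "eventually (\<lambda>z. real (Pi_count z (exp (sqrt (ln z))))
        \<ge> C * (z * exp (- c * sqrt (ln z) * ln (ln z)))) at_top" for c d C :: real
  proof (rule landau_omega.bigI[of 1])
    show "eventually (\<lambda>x. norm (real (NC_count x))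
        \<ge> 1 * norm (x * exp (- d * ln x * (ln (ln (ln x)) / ln (ln x))))) at_top"
      using eventually_NC_count_ge[OF that] eventually_gt_at_top[of 0] by eventually_elim simp
  qed simp
  {
    fix c d :: real
    assume "c > 0" "d > 6 + 2 * c" and *: "(\<lambda>z::real. real (Pi_count z (exp (sqrt (ln z)))))
      \<in> \<Omega>[at_top](\<lambda>z. z * exp (- c * sqrt (ln z) * ln (ln z)))"
    from landau_omega.bigE[OF *] obtain C where C: "C > 0"
      "eventually (\<lambda>z. norm (real (Pi_count z (exp (sqrt (ln z)))))
        \<ge> C * norm (z * exp (- c * sqrt (ln z) * ln (ln z)))) at_top" by blast
    have "eventually (\<lambda>z. real (Pi_count z (exp (sqrt (ln z))))
        \<ge> C * (z * exp (- c * sqrt (ln z) * ln (ln z)))) at_top"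
      using C(2) eventually_gt_at_top[of 0] by eventually_elim simp
    then show "(\<lambda>x::real. real (NC_count x))
        \<in> \<Omega>[at_top](\<lambda>x. x * exp (- d * ln x * (ln (ln (ln x)) / ln (ln x))))"
      using \<open>c > 0\<close> \<open>C > 0\<close> \<open>d > 6 + 2 * c\<close> by (intro omega[of c C d]) auto
  }
  assume "(\<lambda>z::real. real (Pi_count z (exp (sqrt (ln z)))) / real (prime_count z))
      \<sim>[at_top] (\<lambda>z. real (Psi_count z (exp (sqrt (ln z)))) / z)"
  from landau_omega.bigE[OF asymp_equiv_imp_bigomega[OF this]] obtain K where K: "K > 0"
    "eventually (\<lambda>z. norm (real (Pi_count z (exp (sqrt (ln z)))) / real (prime_count z))
      \<ge> K * norm (real (Psi_count z (exp (sqrt (ln z)))) / z)) at_top" by blast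
  have "eventually (\<lambda>z. real (Pi_count z (exp (sqrt (ln z)))) / real (prime_count z)
      \<ge> K * (real (Psi_count z (exp (sqrt (ln z)))) / z)) at_top"
    using K(2) eventually_gt_at_top[of 0] by eventually_elim simp
  from eventually_Pi_count_ge[OF K(1) this] have "(\<lambda>x::real. real (NC_count x))
      \<in> \<Omega>[at_top](\<lambda>x. x * exp (- 7 * ln x * (ln (ln (ln x)) / ln (ln x))))"
    using K(1) by (intro omega[of 2 K]) auto
  then show "\<exists>\<epsilon>::real \<Rightarrow> real. \<epsilon> \<in> o[at_top](\<lambda>_. 1) \<and> (\<lambda>x::real. real (NC_count x))
      \<in> \<Omega>[at_top](\<lambda>x. x * exp (- (7 + \<epsilon> x) * ln x * (ln (ln (ln x)) / ln (ln x))))"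
    by (intro exI[of _ "\<lambda>_. 0"]) simp
qed

end
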